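(* Let $p,r\in\mathbb Z$ and let $q,s,m$ be positive integers with $q<s$ and $rq-ps=1$. Choose a real angle $\vartheta$ satisfying $$\frac pq<\frac{\vartheta}{2\pi}<\frac rs,$$ and put $$A=q\vartheta-2\pi p,\qquad B=\frac{2\pi r-s\vartheta}{m},\qquad e=s-mq.$$ Assume $A+B<\pi$. Let $\omega=\rho e^{i\vartheta}$ with $0<\rho<1$, and let $\beta_1,\ldots,\beta_m\in[0,1)$. Define $$u_j=\operatorname{Arg}(\omega^q-\beta_j),\qquad M=\operatorname{Arg}(\omega^q-1),$$ using arguments in $(0,\pi)$; these satisfy $A\le u_j<M<\pi$. Suppose that both of the following hold: $$\omega^e\prod_{j=1}^m(\omega^q-\beta_j)=\prod_{j=1}^m(1-\beta_j),\qquad e\vartheta+\sum_{j=1}^m u_j=2\pi(r-mp),$$ the second being an equality of real numbers. Then $$\rho^{s/m}\sin A+\rho^q\sin B\le\sin(A+B),$$ with equality if and only if $\beta_1=\cdots=\beta_m$. Consequently $\rho\le\rho_*$, where $\rho_*$ is the unique solution in $(0,1)$ of $$\rho_*^{s/m}\sin A+\rho_*^q\sin B=\sin(A+B).$$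
   Context: $\operatorname{Arg}$ denotes the principal argument; here $\omega^q=\rho^q e^{iA}$ lies in the open upper half-plane, so the arguments used lie in $(0,\pi)$. *)

theory Defs
  imports "HOL-Analysis.Analysis"
begin

end

(* In terms of u_j the factors become 1 - beta_j = |omega^q - beta_j| |omega^q - 1| sin (M - u_j) / Im (omega^q),
   so the modulus equation prescribes the product of the sin (M - u_j), while the argument equation
   says that the u_j have mean A + B. Strict concavity of ln sin bounds that product by
   sin (M - A - B)^m, with equality only for equal u_j; taking m-th roots gives the claim. *)
theory Submission
  imports Defs
begin

text \<open>Strict concavity of ln sin on (0, pi): its derivative \<open>cot\<close> is strictly
  decreasing there, so the mean value theorem, applied on whichever side of \<open>y\<close> the
  point \<open>x\<close> lies, puts the graph strictly below its tangent at
  \<open>y\<close>.\<close>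

lemma ln_sin_less_tangent:
  fixes x y :: real
  assumes "0 < x" "x < pi" "0 < y" "y < pi" "x \<noteq> y"
  shows "ln (sin x) < ln (sin y) + cot y * (x - y)"
proof -
  have der: "((\<lambda>t. ln (sin t)) has_real_derivative cot t) (at t)" if "0 < t" "t < pi" for t
    using sin_gt_zero[OF that] by (auto intro!: derivative_eq_intros simp: cot_def field_simps)
  have cot_less: "cot b < cot a" if "0 < a" "a < b" "b < pi" for a b :: real
  proof -
    have "0 < sin (b - a)" "0 < sin a" "0 < sin b"
      using that by (auto intro!: sin_gt_zero)
    \<comment> \<open>Uses cot a - cot b = sin (b - a) / (sin a * sin b).\<close>
    then show ?thesis
      by (simp add: cot_def sin_diff field_simps)
  qed
  show ?thesis
  proof (cases "x < y")
    case True
    have "\<exists>z>x. z < y \<and> ln (sin y) - ln (sin x) = (y - x) * cot z"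
      by (rule MVT2[OF True]) (use assms der in auto)
    then obtain z where z: "x < z" "z < y" "ln (sin y) - ln (sin x) = (y - x) * cot z"
      by blast
    have "(y - x) * cot y < (y - x) * cot z"
      using cot_less[of z y] z assms True by (intro mult_strict_left_mono) auto
    then show ?thesis
      using z by (simp add: algebra_simps)
  next
    case False
    then have yx: "y < x" using assms by simp
    have "\<exists>z>y. z < x \<and> ln (sin x) - ln (sin y) = (x - y) * cot z"
      by (rule MVT2[OF yx]) (use assms der in auto)
    then obtain z where z: "y < z" "z < x" "ln (sin x) - ln (sin y) = (x - y) * cot z"
      by blast
    have "(x - y) * cot z < (x - y) * cot y"
      using cot_less[of y z] z assms yx by (intro mult_strict_left_mono) auto
    then show ?thesis
      using z by (simp add: algebra_simps)
  qed
qed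

text \<open>Jensen for ln sin: bound each ln (sin (x j)) by the tangent at the mean
  \<open>y\<close>. The linear terms cancel on summing because \<open>y\<close> is the mean, and a
  single \<open>x j\<close> different from \<open>y\<close> makes the summed bound strict.\<close>

lemma prod_sin_mean:
  fixes x :: "'a \<Rightarrow> real" and y :: real
  assumes fin: "finite S"
    and x: "\<And>j. j \<in> S \<Longrightarrow> 0 < x j \<and> x j < pi"
    and y: "0 < y" "y < pi"
    and mean: "(\<Sum>j\<in>S. x j) = real (card S) * y"
  shows "(\<Prod>j\<in>S. sin (x j)) \<le> sin y ^ card S"
    and "(\<Prod>j\<in>S. sin (x j)) = sin y ^ card S \<longleftrightarrow> (\<forall>j\<in>S. x j = y)"
proof -
  define T where "T = (\<lambda>j. ln (sin y) + cot y * (x j - y))"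
  have le: "ln (sin (x j)) \<le> T j" if "j \<in> S" for j
    using ln_sin_less_tangent[of "x j" y] x[OF that] y
    by (cases "x j = y") (auto simp: T_def)
  have sumT: "(\<Sum>j\<in>S. T j) = real (card S) * ln (sin y)"
    by (simp add: T_def sum.distrib sum_distrib_left[symmetric] sum_subtractf mean)
  have pos: "\<And>j. j \<in> S \<Longrightarrow> 0 < sin (x j)" "0 < sin y"
    using x y by (auto intro!: sin_gt_zero)
  have P: "(\<Prod>j\<in>S. sin (x j)) = exp (\<Sum>j\<in>S. ln (sin (x j)))"
    unfolding exp_sum[OF fin] by (rule prod.cong) (use pos in auto)
  have Q: "sin y ^ card S = exp (\<Sum>j\<in>S. T j)"
    using pos by (simp add: sumT exp_of_nat_mult)
  show "(\<Prod>j\<in>S. sin (x j)) \<le> sin y ^ card S"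
    unfolding P Q using le by (simp add: sum_mono)
  show "(\<Prod>j\<in>S. sin (x j)) = sin y ^ card S \<longleftrightarrow> (\<forall>j\<in>S. x j = y)"
  proof
    assume eq: "(\<Prod>j\<in>S. sin (x j)) = sin y ^ card S"
    show "\<forall>j\<in>S. x j = y"
    proof (rule ccontr)
      assume "\<not> (\<forall>j\<in>S. x j = y)"
      then obtain j where j: "j \<in> S" "x j \<noteq> y" by blast
      have "(\<Sum>j\<in>S. ln (sin (x j))) < (\<Sum>j\<in>S. T j)"
        using fin le j ln_sin_less_tangent[of "x j" y] x[OF j(1)] y
        by (intro sum_strict_mono_ex1) (auto simp: T_def)
      then show False using eq unfolding P Q by simp
    qed
  qed simp
qed

lemma norm_mult_sin_Arg_diff:
  assumes "z \<noteq> 0"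
  shows "norm z * sin (Arg z - t) = Im z * cos t - Re z * sin t"
  using assms by (simp add: sin_diff cos_Arg sin_Arg field_simps)

text \<open>Both sides are Im (w * cnj z), the planar cross product of \<open>z\<close> and
  \<open>w\<close>.\<close>

lemma norm_mult_sin_Arg_diff_Arg:
  assumes "w \<noteq> 0" "z \<noteq> 0"
  shows "norm w * norm z * sin (Arg w - Arg z) = Im w * Re z - Re w * Im z"
proof -
  have "norm w * norm z * sin (Arg w - Arg z) = norm z * (Im w * cos (Arg z) - Re w * sin (Arg z))"
    using norm_mult_sin_Arg_diff[OF assms(1), of "Arg z"] by (simp add: mult_ac)
  also have "\<dots> = Im w * Re z - Re w * Im z"
    using assms by (simp add: cos_Arg sin_Arg field_simps)
  finally show ?thesis .
qed

text \<open>For equal imaginary parts the cross product is Im z * (Re z - Re w). Both arguments lie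
  in (0, pi), so their difference lies in (-pi, pi), where its sign is that of its sine.\<close>

lemma Arg_less_Arg_iff_Re:
  assumes "Im w = Im z" "0 < Im z"
  shows "Arg z < Arg w \<longleftrightarrow> Re w < Re z"
proof -
  have less: "Arg z < Arg w" if "Im w = Im z" "0 < Im z" "Re w < Re z" for z w
  proof -
    have nz: "w \<noteq> 0" "z \<noteq> 0" using that by auto
    have "norm w * norm z * sin (Arg w - Arg z) = Im z * (Re z - Re w)"
      using norm_mult_sin_Arg_diff_Arg[OF nz] that by (simp add: algebra_simps)
    also have "\<dots> > 0" using that by simp
    finally have "0 < sin (Arg w - Arg z)"
      using nz by (simp add: zero_less_mult_iff) (meson mult_nonneg_nonneg norm_ge_zero not_less)
    moreover have "Arg z < pi" "0 < Arg w"
      using Arg_lt_pi[of z] Arg_lt_pi[of w] that by auto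
    ultimately show ?thesis
      using sin_ge_zero[of "Arg z - Arg w"] Arg_lt_pi[of w] that
      by (smt (verit) sin_minus)
  qed
  show ?thesis
  proof (cases "Re w = Re z")
    case True
    then have "w = z" using assms by (simp add: complex_eq_iff)
    then show ?thesis by simp
  next
    case False
    then show ?thesis
      using less[of w z] less[of z w] assms by fastforce
  qed
qed

theorem theorem5p2:
  fixes p r e :: int and q s m :: nat
    and \<theta> A B \<rho> M :: real
    and \<omega> :: complex
    and \<beta> u :: "nat \<Rightarrow> real"
  assumes "0 < q" and "0 < s" and "0 < m" and "q < s"
    and "r * int q - p * int s = 1"
    and "real_of_int p / real q < \<theta> / (2 * pi)"
    and "\<theta> / (2 * pi) < real_of_int r / real s"
    and "A = real q * \<theta> - 2 * pi * real_of_int p"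
    and "B = (2 * pi * real_of_int r - real s * \<theta>) / real m"
    and "e = int s - int m * int q"
    and "A + B < pi"
    and "0 < \<rho>" and "\<rho> < 1"
    and "\<omega> = complex_of_real \<rho> * exp (\<i> * complex_of_real \<theta>)"
    and "\<And>j. j \<in> {1..m} \<Longrightarrow> 0 \<le> \<beta> j \<and> \<beta> j < 1"
    and "\<And>j. j \<in> {1..m} \<Longrightarrow> u j = Arg (\<omega> ^ q - complex_of_real (\<beta> j))"
    and "M = Arg (\<omega> ^ q - 1)"
  shows "(0 < A \<and> (\<forall>j\<in>{1..m}. A \<le> u j \<and> u j < M) \<and> M < pi)
    \<and> (\<exists>!\<rho>'. 0 < \<rho>' \<and> \<rho>' < 1 \<and> \<rho>' powr (real s / real m) * sin A + \<rho>' ^ q * sin B = sin (A + B))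
    \<and> (\<omega> powi e * (\<Prod>j = 1..m. (\<omega> ^ q - complex_of_real (\<beta> j)))
           = complex_of_real (\<Prod>j = 1..m. (1 - \<beta> j))
        \<and> real_of_int e * \<theta> + (\<Sum>j = 1..m. u j) = 2 * pi * real_of_int (r - int m * p)
        \<longrightarrow> \<rho> powr (real s / real m) * sin A + \<rho> ^ q * sin B \<le> sin (A + B)
          \<and> (\<rho> powr (real s / real m) * sin A + \<rho> ^ q * sin B = sin (A + B)
               \<longleftrightarrow> (\<forall>i\<in>{1..m}. \<forall>j\<in>{1..m}. \<beta> i = \<beta> j))
          \<and> (\<forall>\<rho>'. 0 < \<rho>' \<and> \<rho>' < 1
               \<and> \<rho>' powr (real s / real m) * sin A + \<rho>' ^ q * sin B = sin (A + B) \<longrightarrow> \<rho> \<le> \<rho>'))"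
proof -
  define t where "t = A + B"
  define a where "a = \<rho> ^ q"
  define F where "F = (\<lambda>x. x powr (real s / real m) * sin A + x ^ q * sin B)"
  note q = assms(1) and s = assms(2) and m = assms(3) and \<rho> = assms(12,13)

  \<comment> \<open>The two bounds on \<theta> / (2 pi) say exactly that \<open>A\<close> and
    \<open>B\<close> are positive.\<close>
  have A0: "0 < A"
    using assms(6) q by (simp add: assms(8) field_simps)
  have B0: "0 < B"
    using assms(7) s m by (simp add: assms(9) field_simps)
  have tpi: "t < pi" using assms(11) by (simp add: t_def)
  have Api: "A < pi" and Bpi: "B < pi" using A0 B0 assms(11) by auto
  have sinA: "0 < sin A" and sinB: "0 < sin B" and sint: "0 < sin t"
    using A0 B0 Api Bpi tpi by (auto intro!: sin_gt_zero simp: t_def)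
  have a: "0 < a" "a < 1"
    using \<rho> q by (auto simp: a_def power_less_one_iff)

  have wq: "\<omega> ^ q = complex_of_real a * cis A"
  proof -
    have "\<omega> ^ q = complex_of_real a * cis (real q * \<theta>)"
      by (simp add: assms(14) power_mult_distrib a_def Complex.DeMoivre flip: cis_conv_exp)
    \<comment> \<open>Removing \<open>p\<close> full turns brings the angle into (0, pi), so that
      \<open>A\<close> is the principal argument.\<close>
    also have "real q * \<theta> = A + 2 * pi * real_of_int p" by (simp add: assms(8))
    also have "cis \<dots> = cis A"
      by (simp add: cis_mult[symmetric] cis_multiple_2pi)
    finally show ?thesis .
  qed
  have ReIm: "Re (\<omega> ^ q) = a * cos A" "Im (\<omega> ^ q) = a * sin A"
    by (simp_all add: wq)
  have Im0: "0 < a * sin A" using a sinA by simp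
  have ArgA: "Arg (\<omega> ^ q) = A"
    unfolding wq using a A0 Api by (intro Arg_unique[of a]) (auto simp: cis_conv_exp)

  define z where "z = (\<lambda>j. \<omega> ^ q - complex_of_real (\<beta> j))"
  define w where "w = \<omega> ^ q - 1"
  have Rez: "Re (z j) = a * cos A - \<beta> j" and Imz: "Im (z j) = a * sin A" for j
    by (simp_all add: z_def ReIm)
  have Rew: "Re w = a * cos A - 1" and Imw: "Im w = a * sin A"
    by (simp_all add: w_def ReIm)
  have \<beta>: "0 \<le> \<beta> j" "\<beta> j < 1" and u: "u j = Arg (z j)" if "j \<in> {1..m}" for j
    using assms(15,16)[OF that] by (auto simp: z_def)
  have M: "M = Arg w" by (simp add: assms(17) w_def)
  have nz: "z j \<noteq> 0" "w \<noteq> 0" for j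
    using Imz[of j] Imw Im0 by auto

  have Mpi: "M < pi" using Arg_lt_pi[of w] Im0 by (simp add: M Imw)
  \<comment> \<open>The points \<omega>^q, \<open>z j\<close> and \<open>w\<close> are on one
    horizontal line above the real axis, ordered from right to left since 0 \<le> \<beta> j < 1;
    moving left increases the argument.\<close>
  have Au: "A \<le> u j" if j: "j \<in> {1..m}" for j
    using Arg_less_Arg_iff_Re[of "\<omega> ^ q" "z j"] \<beta>[OF j] Im0
    by (simp add: u[OF j] ArgA Rez Imz ReIm not_less[symmetric])
  have uM: "u j < M" if j: "j \<in> {1..m}" for j
    using Arg_less_Arg_iff_Re[of w "z j"] \<beta>[OF j] Im0
    by (simp add: u[OF j] M Rez Imz Rew Imw)
  have u_eq: "u i = u j \<longleftrightarrow> \<beta> i = \<beta> j" if "i \<in> {1..m}" "j \<in> {1..m}" for i j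
    using Arg_less_Arg_iff_Re[of "z i" "z j"] Arg_less_Arg_iff_Re[of "z j" "z i"] Im0
    by (simp add: u[OF that(1)] u[OF that(2)] Rez Imz) (metis less_irrefl linorder_neqE)

  have F_less: "F x < F y" if "0 \<le> x" "x < y" for x y
    unfolding F_def using that sinA sinB q s m
    by (intro add_strict_mono mult_strict_right_mono powr_less_mono2 power_strict_mono) auto
  \<comment> \<open>\<open>F\<close> is continuous and strictly increasing on [0, 1], with F 0 = 0 <
    sin (A + B). At 1 the addition formula gives sin (A + B) < sin A + sin B = F 1, as both cosines
    are below 1.\<close>
  have ex1: "\<exists>!\<rho>'. 0 < \<rho>' \<and> \<rho>' < 1 \<and> F \<rho>' = sin (A + B)"
  proof -
    have F0: "F 0 = 0" using q by (simp add: F_def)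
    have F1: "sin (A + B) < F 1"
    proof -
      have "cos B < 1" "cos A < 1"
        using A0 B0 Api Bpi cos_monotone_0_pi[of 0 A] cos_monotone_0_pi[of 0 B] by auto
      then have "sin A * cos B < sin A * 1" "cos A * sin B < 1 * sin B"
        using sinA sinB by (simp_all only: mult_strict_left_mono mult_strict_right_mono)
      then show ?thesis by (simp add: F_def sin_add)
    qed
    have "continuous_on {0..1} F"
      unfolding F_def using s m by (intro continuous_intros continuous_on_powr') auto
    then obtain x where x: "0 \<le> x" "x \<le> 1" "F x = sin (A + B)"
      using IVT'[of F 0 "sin (A + B)" 1] F0 F1 sint by (auto simp: t_def)
    have "x \<noteq> 0" "x \<noteq> 1" using F0 F1 x sint by (auto simp: t_def)
    then have "0 < x \<and> x < 1 \<and> F x = sin (A + B)" using x by simp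
    moreover have "y = x" if "0 < y \<and> y < 1 \<and> F y = sin (A + B)" for y
      using F_less[of x y] F_less[of y x] that x by fastforce
    ultimately show ?thesis by blast
  qed

  have main: "F \<rho> \<le> sin (A + B)
      \<and> (F \<rho> = sin (A + B) \<longleftrightarrow> (\<forall>i\<in>{1..m}. \<forall>j\<in>{1..m}. \<beta> i = \<beta> j))"
    if mod: "\<omega> powi e * (\<Prod>j = 1..m. z j) = complex_of_real (\<Prod>j = 1..m. (1 - \<beta> j))"
      and arg: "real_of_int e * \<theta> + (\<Sum>j = 1..m. u j) = 2 * pi * real_of_int (r - int m * p)"
  proof -
    \<comment> \<open>The Jensen bound is applied to the gaps \<open>x j\<close>, whose mean is
      \<open>y\<close>. The claim takes the form L \<le> X, to be proved by comparing m-th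
      powers.\<close>
    define x where "x = (\<lambda>j. M - u j)"
    define y where "y = M - t"
    define L where "L = \<rho> powr (real s / real m) * sin A"
    define X where "X = norm w * sin y"
    \<comment> \<open>Substituting e = s - m q into the argument equation leaves m A + m B.\<close>
    have usum: "(\<Sum>j = 1..m. u j) = real m * t"
    proof -
      have "real m * B = 2 * pi * real_of_int r - real s * \<theta>"
        using m by (simp add: assms(9))
      then show ?thesis using arg by (simp add: t_def assms(8,10) algebra_simps)
    qed
    have xsum: "(\<Sum>j = 1..m. x j) = real (card {1..m}) * y"
      using usum by (simp add: x_def y_def sum_subtractf algebra_simps)
    have xpos: "0 < x j \<and> x j < pi" if "j \<in> {1..m}" for j
      using uM[OF that] Au[OF that] A0 Mpi by (simp add: x_def)
    \<comment> \<open>That t < M is not among the hypotheses: \<open>y\<close> is positive as the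
      mean of positive gaps.\<close>
    have "(\<Sum>j = 1..m. x j) > 0"
      using xpos m by (intro sum_pos) auto
    then have y0: "0 < y" using m unfolding xsum by (simp add: zero_less_mult_iff)
    have ypi: "y < pi" using Mpi A0 B0 by (simp add: y_def t_def)
    note J = prod_sin_mean[OF finite_atLeastAtMost xpos y0 ypi xsum]

    \<comment> \<open>Expand |w| sin (M - t) by the real and imaginary parts of \<open>w\<close> and
      use t - A = B.\<close>
    have X: "X = sin (A + B) - \<rho> ^ q * sin B"
    proof -
      have "X = a * sin A * cos t - (a * cos A - 1) * sin t"
        unfolding X_def y_def M using norm_mult_sin_Arg_diff[OF nz(2), of t]
        by (simp add: Rew Imw)
      also have "\<dots> = sin t - a * sin (t - A)"
        by (simp add: sin_diff algebra_simps)
      finally show ?thesis by (simp add: t_def a_def)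
    qed
    have X0: "0 < X" using nz y0 ypi by (simp add: X_def sin_gt_zero)
    have L0: "0 < L" using \<rho> sinA by (simp add: L_def)

    \<comment> \<open>The cross product of \<open>z j\<close> and \<open>w\<close>: their common
      height a sin A times their horizontal distance 1 - \<beta> j.\<close>
    have factor: "norm w * sin (x j) * norm (z j) = a * sin A * (1 - \<beta> j)"
      if j: "j \<in> {1..m}" for j
      using norm_mult_sin_Arg_diff_Arg[OF nz(2) nz(1)[of j]]
      by (simp add: x_def u[OF j] M Rez Imz Rew Imw algebra_simps)
    have "norm w ^ m * (\<Prod>j = 1..m. sin (x j)) * (\<Prod>j = 1..m. norm (z j))
        = (\<Prod>j = 1..m. norm w * sin (x j) * norm (z j))"
      by (simp add: prod.distrib)
    also have "\<dots> = (\<Prod>j = 1..m. a * sin A * (1 - \<beta> j))"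
      by (rule prod.cong) (use factor in auto)
    also have "\<dots> = (a * sin A) ^ m * (\<Prod>j = 1..m. (1 - \<beta> j))"
      by (simp add: prod.distrib)
    \<comment> \<open>Norms in the modulus equation. The nonzero product of the norms of the
      \<open>z j\<close> then occurs on both sides and cancels.\<close>
    also have "(\<Prod>j = 1..m. (1 - \<beta> j)) = \<rho> powi e * (\<Prod>j = 1..m. norm (z j))"
    proof -
      have "norm \<omega> = \<rho>" using \<rho> by (simp add: assms(14) norm_mult)
      moreover have "0 \<le> (\<Prod>j = 1..m. (1 - \<beta> j))"
        using \<beta> by (intro prod_nonneg) (auto simp: less_imp_le)
      ultimately show ?thesis
        using arg_cong[OF mod, of norm]
        by (simp only: norm_mult norm_power_int prod_norm[symmetric] norm_of_real abs_of_nonneg)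
    qed
    finally have "norm w ^ m * (\<Prod>j = 1..m. sin (x j)) = (a * sin A) ^ m * \<rho> powi e"
      using nz by simp
    \<comment> \<open>The exponents of \<rho> add up to m q + e = s, which is the m-th power of the
      exponent s / m; \<open>powi\<close> is used because \<open>e\<close> may be negative.\<close>
    also have "\<dots> = L ^ m"
    proof -
      have "(\<rho> powr (real s / real m)) ^ m = \<rho> ^ s"
        using \<rho> m powr_realpow[of "\<rho> powr (real s / real m)" m] powr_realpow[of \<rho> s]
        by (simp add: powr_powr)
      moreover have "a ^ m * \<rho> powi e = \<rho> ^ s"
      proof -
        have "a ^ m * \<rho> powi e = \<rho> powi (int (m * q)) * \<rho> powi e"
          by (simp only: a_def power_int_of_nat power_mult[symmetric] mult.commute[of q m])
        also have "\<dots> = \<rho> powi (int s)"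
          using \<rho> by (simp add: power_int_add[symmetric] assms(10) del: power_int_of_nat)
        finally show ?thesis by simp
      qed
      ultimately show ?thesis
        by (simp add: L_def power_mult_distrib mult_ac)
    qed
    finally have L: "L ^ m = norm w ^ m * (\<Prod>j = 1..m. sin (x j))" by simp
    have Xm: "X ^ m = norm w ^ m * sin y ^ m" by (simp add: X_def power_mult_distrib)

    have "L ^ m \<le> X ^ m" using J(1) by (simp add: L Xm mult_left_mono)
    then have "L \<le> X" using L0 X0 m by simp
    moreover have "L = X \<longleftrightarrow> (\<forall>i\<in>{1..m}. \<forall>j\<in>{1..m}. \<beta> i = \<beta> j)"
    proof -
      have "L = X \<longleftrightarrow> L ^ m = X ^ m"
        using L0 X0 m by (simp add: power_eq_iff_eq_base)
      also have "\<dots> \<longleftrightarrow> (\<Prod>j = 1..m. sin (x j)) = sin y ^ card {1..m}"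
        using nz by (simp add: L Xm)
      also have "\<dots> \<longleftrightarrow> (\<forall>j\<in>{1..m}. x j = y)" by (rule J(2))
      also have "\<dots> \<longleftrightarrow> (\<forall>j\<in>{1..m}. u j = t)" by (auto simp: x_def y_def)
      \<comment> \<open>The mean of the \<open>u j\<close> is \<open>t\<close>, so if they all
        agree, their common value is \<open>t\<close>.\<close>
      also have "\<dots> \<longleftrightarrow> (\<forall>i\<in>{1..m}. \<forall>j\<in>{1..m}. u i = u j)"
      proof
        assume eq: "\<forall>i\<in>{1..m}. \<forall>j\<in>{1..m}. u i = u j"
        show "\<forall>j\<in>{1..m}. u j = t"
        proof
          fix j assume j: "j \<in> {1..m}"
          have "(\<Sum>i = 1..m. u i) = (\<Sum>i = 1..m. u j)"
            by (rule sum.cong[OF refl]) (use eq j in blast)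
          then show "u j = t" using usum m by simp
        qed
      qed simp
      also have "\<dots> \<longleftrightarrow> (\<forall>i\<in>{1..m}. \<forall>j\<in>{1..m}. \<beta> i = \<beta> j)"
        using u_eq by blast
      finally show ?thesis .
    qed
    ultimately show ?thesis
      unfolding F_def L_def[symmetric] by (simp add: X le_diff_eq eq_diff_eq)
  qed

  \<comment> \<open>If \<rho>' < \<rho>, strict monotonicity would give F \<rho> > F \<rho>' = sin
    (A + B).\<close>
  have "\<rho> \<le> \<rho>'" if "F \<rho> \<le> sin (A + B)" "0 < \<rho>'" "F \<rho>' = sin (A + B)" for \<rho>'
    using F_less[of \<rho>' \<rho>] that by fastforce
  then show ?thesis
    using A0 Au uM Mpi ex1 main unfolding F_def z_def by blast
qed

end
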